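(* Assume the Deep Riemann Hypothesis (DRH) for the normalized Ramanujan $L$-function $L(s+\tfrac{11}{2},\Delta)$, i.e. assume that $$\lim_{x\to\infty}\prod_{p\le x}\left(1-2\cos(\theta(p))\,p^{-1/2}+p^{-1}\right)^{-1}=\sqrt{2}^{\,\delta(M)}\,L(6,\Delta),\qquad \delta(M)=-1,$$ where the product runs over primes $p\le x$. Then $$\sum_{p\le x}\frac{\tau(p)}{p^{6}}\sim \frac12\log\log x\qquad (x\to\infty),$$ where the sum runs over all primes $p\le x$.
   Context: Ramanujan's function $\tau(n)\in\mathbb{Z}$ is defined by $$\Delta(z)=q\prod_{k=1}^{\infty}(1-q^k)^{24}=\sum_{n=1}^{\infty}\tau(n)q^n,\qquad q=e^{2\pi i z},\ \mathrm{Im}(z)>0.$$ For each prime $p$, $\theta(p)\in[0,\pi]$ is defined by $\tau(p)=2p^{11/2}\cos(\theta(p))$, and $$M(p)=\begin{pmatrix}e^{i\theta(p)}&0\\0&e^{-i\theta(p)}\end{pmatrix}.$$ Ramanujan's $L$-function is $L(s,\Delta)=\sum_{n\ge1}\tau(n)n^{-s}$, extended by analytic continuation to an entire function on $\mathbb{C}$. The normalized $L$-function is $$L(s,M)=L\left(s+\tfrac{11}{2},\Delta\right)=\prod_p\left(1-2\cos(\theta(p))p^{-s}+p^{-2s}\right)^{-1}\quad(\mathrm{Re}(s)>1),$$ which has an entire continuation and a functional equation relating $s$ and $1-s$; in particular $L(\tfrac12,M)=L(6,\Delta)$. It is a standing assumption that $L(\tfrac12,M)\neq0$. In general, for unitary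 matrices $M(p)$ indexed by primes, with $L(s,M)=\prod_p\det(1-M(p)p^{-s})^{-1}$, the DRH for $L(s,M)$ is the assertion that the Euler product converges at $s=\tfrac12$ with $\lim_{x\to\infty}\prod_{p\le x}\det(1-M(p)p^{-1/2})^{-1}=\sqrt{2}^{\,\delta(M)}L(\tfrac12,M)$, where $\delta(M)$ is the order of the pole at $s=1$ (negative in case of a zero) of $L(s,M^2)=\prod_p\det(1-M(p)^2p^{-s})^{-1}$. For the $M$ above, $\delta(M)=-1$. $f(x)\sim g(x)$ $(x\to\infty)$ means $\lim_{x\to\infty}f(x)/g(x)=1$. *)

theory Defs
  imports "HOL-Complex_Analysis.Complex_Analysis" "HOL-Library.Landau_Symbols"
begin

text \<open>The infinite product is taken in the topological ring of formal power series over the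
  integers; the library indexes it from \<open>0\<close>, hence the \<open>Suc\<close>. Lemma \<open>ramanujan_tau_sums\<close> is the
  defining identity for the holomorphic function \<open>\<Delta>\<close> on the upper half plane.\<close>

definition Delta_fps :: "int fps" where
  "Delta_fps = fps_X * (\<Prod>k. (1 - fps_X ^ Suc k) ^ 24)"

definition ramanujan_tau :: "nat \<Rightarrow> int" where
  "ramanujan_tau n = fps_nth Delta_fps n"

definition ramanujan_Delta :: "complex \<Rightarrow> complex" where
  "ramanujan_Delta z =
     (let q = exp (2 * of_real pi * \<i> * z) in q * (\<Prod>k. (1 - q ^ Suc k) ^ 24))"

lemma dvd_factor_minus_1:
  fixes a :: "'a :: comm_ring_1"
  shows "a dvd (1 - a) ^ 24 - 1"
proof -
  have "(1 - a) ^ 24 - 1 = ((1 - a) - 1) * (\<Sum>i<24. (1 - a) ^ i)"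
    by (rule power_diff_1_eq)
  hence "(1 - a) ^ 24 - 1 = a * (- (\<Sum>i<24. (1 - a) ^ i))" by simp
  thus ?thesis by (rule dvdI)
qed

definition eta24_fps :: "'a :: idom fps" where
  "eta24_fps = Abs_fps (\<lambda>n. fps_nth (\<Prod>k\<le>n. (1 - fps_X ^ Suc k) ^ 24) n)"

lemma fps_nth_partial_prod:
  fixes n N :: nat
  assumes "n \<le> N"
  shows "fps_nth (\<Prod>k\<le>N. (1 - fps_X ^ Suc k) ^ 24 :: 'a :: idom fps) n = fps_nth eta24_fps n"
  using assms
proof (induction N rule: dec_induct)
  case base
  show ?case by (simp add: eta24_fps_def)
next
  case (step N)
  define p :: "'a fps" where "p = (\<Prod>k\<le>N. (1 - fps_X ^ Suc k) ^ 24)"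
  obtain h where h: "(1 - fps_X ^ Suc (Suc N)) ^ 24 - 1 = (fps_X ^ Suc (Suc N) * h :: 'a fps)"
    using dvd_factor_minus_1 by (metis dvdE)
  have h': "(1 - fps_X ^ Suc (Suc N)) ^ 24 = (1 + fps_X ^ Suc (Suc N) * h :: 'a fps)"
    using h by (metis add.commute diff_add_cancel)
  have "(\<Prod>k\<le>Suc N. (1 - fps_X ^ Suc k) ^ 24 :: 'a fps) = p * (1 + fps_X ^ Suc (Suc N) * h)"
    unfolding p_def prod.atMost_Suc h' ..
  also have "\<dots> = p + fps_X ^ Suc (Suc N) * (h * p)"
    by (simp only: distrib_left mult_1_right mult.assoc mult.commute[of p])
  also have "fps_nth \<dots> n = fps_nth p n"
    unfolding fps_add_nth fps_X_power_mult_nth using step by simp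
  finally show ?case using step unfolding p_def by simp
qed

lemma tendsto_eta24_fps:
  "(\<lambda>N. \<Prod>k\<le>N. (1 - fps_X ^ Suc k) ^ 24 :: 'a :: idom fps) \<longlonglongrightarrow> eta24_fps"
proof (rule tendsto_fpsI)
  fix n
  show "\<forall>\<^sub>F N in sequentially.
          fps_nth (\<Prod>k\<le>N. (1 - fps_X ^ Suc k) ^ 24 :: 'a fps) n = fps_nth eta24_fps n"
    using eventually_ge_at_top[of n] by eventually_elim (rule fps_nth_partial_prod)
qed

lemma eta24_fps_has_prod: "(\<lambda>k. (1 - fps_X ^ Suc k) ^ 24 :: int fps) has_prod eta24_fps"
proof -
  have "fps_nth (eta24_fps :: int fps) 0 = 1"
    by (simp add: eta24_fps_def fps_nth_power_0)
  hence "(eta24_fps :: int fps) \<noteq> 0" by auto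
  thus ?thesis
    using tendsto_eta24_fps[where ?'a = int] by (simp add: has_prod_def raw_has_prod_def)
qed

lemma Delta_fps_eq: "Delta_fps = fps_X * eta24_fps"
  unfolding Delta_fps_def by (simp only: has_prod_unique[OF eta24_fps_has_prod, symmetric])

definition fps_of_int_fps :: "int fps \<Rightarrow> complex fps" where
  "fps_of_int_fps F = Abs_fps (\<lambda>n. of_int (fps_nth F n))"

lemma fps_of_int_fps_mult: "fps_of_int_fps (F * G) = fps_of_int_fps F * fps_of_int_fps G"
  by (simp add: fps_of_int_fps_def fps_eq_iff fps_mult_nth)

lemma fps_of_int_fps_1: "fps_of_int_fps 1 = 1"
  by (simp add: fps_of_int_fps_def fps_eq_iff)

lemma fps_of_int_fps_diff: "fps_of_int_fps (F - G) = fps_of_int_fps F - fps_of_int_fps G"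
  by (simp add: fps_of_int_fps_def fps_eq_iff)

lemma fps_of_int_fps_X: "fps_of_int_fps fps_X = fps_X"
  by (simp add: fps_of_int_fps_def fps_eq_iff fps_X_def)

lemma fps_of_int_fps_power: "fps_of_int_fps (F ^ n) = fps_of_int_fps F ^ n"
  by (induction n) (simp_all add: fps_of_int_fps_1 fps_of_int_fps_mult)

lemma fps_of_int_fps_prod: "fps_of_int_fps (\<Prod>k\<le>(n::nat). f k) = (\<Prod>k\<le>n. fps_of_int_fps (f k))"
  by (induction n) (simp_all add: fps_of_int_fps_mult)

lemma fps_of_int_eta24: "fps_of_int_fps eta24_fps = eta24_fps"
proof (rule fps_ext)
  fix n
  have "fps_nth (fps_of_int_fps eta24_fps) n =
        fps_nth (fps_of_int_fps (\<Prod>k\<le>n. (1 - fps_X ^ Suc k) ^ 24)) n"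
    by (simp add: fps_of_int_fps_def eta24_fps_def)
  also have "\<dots> = fps_nth eta24_fps n"
    unfolding fps_of_int_fps_prod fps_of_int_fps_power fps_of_int_fps_diff fps_of_int_fps_1
      fps_of_int_fps_X by (simp add: eta24_fps_def)
  finally show "fps_nth (fps_of_int_fps eta24_fps) n = fps_nth eta24_fps n" .
qed

lemma eta24_factor_bound:
  fixes w :: complex
  assumes "norm w \<le> 1"
  shows "norm ((1 - w) ^ 24 - 1) \<le> norm w * (\<Sum>i<24::nat. 2 ^ i)"
proof -
  have "(1 - w) ^ 24 - 1 = ((1 - w) - 1) * (\<Sum>i<24. (1 - w) ^ i)"
    by (rule power_diff_1_eq)
  hence "norm ((1 - w) ^ 24 - 1) = norm w * norm (\<Sum>i<24. (1 - w) ^ i)"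
    by (simp add: norm_mult)
  also have "norm (\<Sum>i<24::nat. (1 - w) ^ i) \<le> (\<Sum>i<24. 2 ^ i)"
  proof (rule sum_norm_le)
    fix i :: nat
    have "norm (1 - w) \<le> 2" using norm_triangle_ineq4[of 1 w] assms by simp
    thus "norm ((1 - w) ^ i) \<le> 2 ^ i" by (simp add: norm_power power_mono)
  qed
  finally show ?thesis by (simp add: mult_left_mono)
qed

lemma eta24_convergent_prod:
  fixes q :: complex
  assumes "norm q < 1"
  shows "convergent_prod (\<lambda>k. (1 - q ^ Suc k) ^ 24)"
proof -
  have "summable (\<lambda>k. norm q ^ Suc k * (\<Sum>i<24::nat. 2 ^ i :: real))"
    using assms by (intro summable_mult2) (simp add: summable_Suc_iff summable_geometric)
  hence "summable (\<lambda>k. norm ((1 - q ^ Suc k) ^ 24 - 1))"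
  proof (rule summable_comparison_test')
    fix k :: nat
    have "norm (q ^ Suc k) \<le> 1"
      unfolding norm_power using assms by (intro power_le_one) auto
    from eta24_factor_bound[OF this]
    show "norm (norm ((1 - q ^ Suc k) ^ 24 - 1)) \<le> norm q ^ Suc k * (\<Sum>i<24::nat. 2 ^ i)"
      unfolding norm_power by simp
  qed
  hence "abs_convergent_prod (\<lambda>k. (1 - q ^ Suc k) ^ 24)"
    by (simp only: summable_imp_abs_convergent_prod)
  thus ?thesis by (rule abs_convergent_prod_imp_convergent_prod)
qed

lemma eta24_uniform_limit:
  fixes r :: real
  assumes r: "r < 1"
  shows "uniform_limit (cball 0 r) (\<lambda>N q. \<Prod>k\<le>N. (1 - q ^ Suc k) ^ 24)
           (\<lambda>q::complex. \<Prod>k. (1 - q ^ Suc k) ^ 24) sequentially"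
proof (cases "r < 0")
  case True
  thus ?thesis by simp
next
  case False
  hence r0: "0 \<le> r" by simp
  have "uniformly_convergent_on (cball 0 r) (\<lambda>N (q::complex). \<Sum>n<N. norm ((1 - q ^ Suc n) ^ 24 - 1))"
  proof (rule Weierstrass_m_test')
    show "summable (\<lambda>k. r ^ Suc k * (\<Sum>i<24::nat. 2 ^ i :: real))"
      using r r0 by (intro summable_mult2) (simp add: summable_Suc_iff summable_geometric)
  next
    fix k :: nat and q :: complex assume q: "q \<in> cball 0 r"
    have le: "norm (q ^ Suc k) \<le> r ^ Suc k"
      unfolding norm_power using q by (intro power_mono) auto
    also have "\<dots> \<le> 1" using r r0 by (intro power_le_one) auto
    finally have "norm ((1 - q ^ Suc k) ^ 24 - 1) \<le> norm (q ^ Suc k) * (\<Sum>i<24::nat. 2 ^ i)"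
      by (rule eta24_factor_bound)
    also have "\<dots> \<le> r ^ Suc k * (\<Sum>i<24::nat. 2 ^ i)"
      by (intro mult_right_mono le sum_nonneg) auto
    finally show "norm (norm ((1 - q ^ Suc k) ^ 24 - 1)) \<le> r ^ Suc k * (\<Sum>i<24::nat. 2 ^ i)"
      by simp
  qed
  hence "uniformly_convergent_on (cball 0 r) (\<lambda>N (q::complex). \<Prod>n<N. (1 - q ^ Suc n) ^ 24)"
    by (intro uniformly_convergent_on_prod' continuous_intros) auto
  then obtain l where "uniform_limit (cball 0 r)
      (\<lambda>N (q::complex). \<Prod>n<N. (1 - q ^ Suc n) ^ 24) l sequentially"
    by (auto simp: uniformly_convergent_on_def)
  hence l: "uniform_limit (cball 0 r)
      (\<lambda>N (q::complex). \<Prod>n\<le>N. (1 - q ^ Suc n) ^ 24) l sequentially"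
    unfolding lessThan_Suc_atMost[symmetric] by (rule filterlim_compose[OF _ filterlim_Suc])
  have "l q = (\<Prod>k. (1 - q ^ Suc k) ^ 24)" if q: "q \<in> cball 0 r" for q
  proof (rule LIMSEQ_unique)
    show "(\<lambda>N. \<Prod>n\<le>N. (1 - q ^ Suc n) ^ 24) \<longlonglongrightarrow> l q"
      by (rule tendsto_uniform_limitI[OF l q])
    show "(\<lambda>N. \<Prod>n\<le>N. (1 - q ^ Suc n) ^ 24) \<longlonglongrightarrow> (\<Prod>k. (1 - q ^ Suc k) ^ 24)"
      using q r by (intro convergent_prod_LIMSEQ eta24_convergent_prod) auto
  qed
  with l show ?thesis by (subst uniform_limit_cong'[symmetric]) (rule refl, assumption+)
qed

lemma eta24_holomorphic: "(\<lambda>q. \<Prod>k. (1 - q ^ Suc k) ^ 24) holomorphic_on ball (0::complex) 1"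
proof (rule holomorphic_uniform_sequence)
  show "(\<lambda>q::complex. \<Prod>k\<le>N. (1 - q ^ Suc k) ^ 24) holomorphic_on ball 0 1" for N
    by (intro holomorphic_intros)
next
  fix x :: complex assume x: "x \<in> ball 0 1"
  define d where "d = (1 - norm x) / 2"
  have d: "d > 0" using x by (simp add: d_def)
  have sub: "cball x d \<subseteq> cball 0 ((1 + norm x) / 2)"
  proof
    fix y assume "y \<in> cball x d"
    hence "norm (y - x) \<le> d" by (simp add: dist_norm norm_minus_commute)
    hence "norm y \<le> norm x + d" using norm_triangle_ineq[of x "y - x"] by simp
    thus "y \<in> cball 0 ((1 + norm x) / 2)" by (simp add: d_def field_simps)
  qed
  have "cball 0 ((1 + norm x) / 2) \<subseteq> ball (0::complex) 1" using x by auto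
  moreover have "uniform_limit (cball 0 ((1 + norm x) / 2)) (\<lambda>N q. \<Prod>k\<le>N. (1 - q ^ Suc k) ^ 24)
           (\<lambda>q::complex. \<Prod>k. (1 - q ^ Suc k) ^ 24) sequentially"
    using x by (intro eta24_uniform_limit) auto
  ultimately show "\<exists>d>0. cball x d \<subseteq> ball 0 1 \<and> uniform_limit (cball x d)
      (\<lambda>N q. \<Prod>k\<le>N. (1 - q ^ Suc k) ^ 24) (\<lambda>q::complex. \<Prod>k. (1 - q ^ Suc k) ^ 24) sequentially"
    using d sub uniform_limit_on_subset by (intro exI[of _ d]) blast
qed auto

lemma eta24_sums:
  fixes q :: complex
  assumes "norm q < 1"
  shows "(\<lambda>n. fps_nth eta24_fps n * q ^ n) sums (\<Prod>k. (1 - q ^ Suc k) ^ 24)"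
proof -
  let ?g = "\<lambda>q::complex. \<Prod>k. (1 - q ^ Suc k) ^ 24"
  have ex: "?g has_fps_expansion fps_expansion ?g 0"
    by (rule has_fps_expansion_fps_expansion[OF _ _ eta24_holomorphic]) auto
  have "fps_expansion ?g 0 = eta24_fps"
  proof (rule uniform_limit_imp_fps_expansion_eq[OF tendsto_eta24_fps _ _ ex])
    show "uniform_limit (ball 0 (1/2)) (\<lambda>N q. \<Prod>k\<le>N. (1 - q ^ Suc k) ^ 24) ?g sequentially"
      by (rule uniform_limit_on_subset[OF eta24_uniform_limit[of "1/2"]]) auto
    show "\<forall>\<^sub>F N in sequentially. (\<lambda>q::complex. \<Prod>k\<le>N. (1 - q ^ Suc k) ^ 24)
            has_fps_expansion (\<Prod>k\<le>N. (1 - fps_X ^ Suc k) ^ 24)"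
      by (intro always_eventually allI fps_expansion_intros)
    show "\<forall>\<^sub>F N in sequentially. (\<lambda>q::complex. \<Prod>k\<le>N. (1 - q ^ Suc k) ^ 24)
            holomorphic_on ball 0 (1/2)"
      by (intro always_eventually allI holomorphic_intros)
  qed auto
  moreover have "(\<lambda>n. (deriv ^^ n) ?g 0 / fact n * (q - 0) ^ n) sums ?g q"
    using assms by (intro holomorphic_power_series[OF eta24_holomorphic]) auto
  moreover have "fps_nth (fps_expansion ?g 0) n = (deriv ^^ n) ?g 0 / fact n" for n
    by (simp add: fps_expansion_def)
  ultimately show ?thesis by simp
qed

theorem ramanujan_tau_sums:
  assumes "Im z > 0"
  shows "(\<lambda>n. of_int (ramanujan_tau n) * exp (2 * of_real pi * \<i> * z) ^ n) sums ramanujan_Delta z"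
proof -
  define q where "q = exp (2 * of_real pi * \<i> * z)"
  have "norm q < 1" using assms by (simp add: q_def)
  from sums_mult[OF eta24_sums[OF this], of q]
  have "(\<lambda>n. q * (fps_nth eta24_fps n * q ^ n)) sums ramanujan_Delta z"
    by (simp add: ramanujan_Delta_def q_def Let_def)
  moreover have "q * (fps_nth eta24_fps n * q ^ n) = of_int (ramanujan_tau (Suc n)) * q ^ Suc n" for n
    by (subst fps_of_int_eta24[symmetric])
       (simp add: ramanujan_tau_def Delta_fps_eq fps_of_int_fps_def)
  ultimately have "(\<lambda>n. of_int (ramanujan_tau (Suc n)) * q ^ Suc n) sums ramanujan_Delta z"
    by simp
  moreover have "ramanujan_tau 0 = 0"
    by (simp add: ramanujan_tau_def Delta_fps_eq)
  ultimately show ?thesis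
    unfolding q_def[symmetric] by (subst (asm) sums_Suc_iff) simp
qed

text \<open>The half plane is \<open>Re (s - 11/2) > 1\<close>, where the normalized Euler product converges absolutely.
  An entire function with this property is unique (\<open>ramanujan_L_eqI\<close>), so the description below
  denotes the analytic continuation.\<close>

definition is_ramanujan_L :: "(complex \<Rightarrow> complex) \<Rightarrow> bool" where
  "is_ramanujan_L f \<longleftrightarrow> f holomorphic_on UNIV \<and>
     (\<forall>s. Re s > 13 / 2 \<longrightarrow>
        (\<lambda>n. of_int (ramanujan_tau (Suc n)) * of_nat (Suc n) powr (-s)) sums f s)"

definition ramanujan_L :: "complex \<Rightarrow> complex" where
  "ramanujan_L = (THE f. is_ramanujan_L f)"

lemma ramanujan_L_eqI:
  assumes f: "is_ramanujan_L f"
  shows "ramanujan_L = f"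
  unfolding ramanujan_L_def
proof (rule the_equality[where P = is_ramanujan_L])
  show "is_ramanujan_L f" by (rule f)
next
  fix g assume g: "is_ramanujan_L g"
  have *: "open {s :: complex. Re s > 13 / 2}" by (rule open_halfspace_Re_gt)
  have ne: "{s :: complex. Re s > 13 / 2} \<noteq> {}" by (auto intro!: exI[of _ "7::complex"])
  show "g = f"
  proof
    fix s
    show "g s = f s"
    proof (rule analytic_continuation_open[where f = g and g = f and z = s,
            OF * open_UNIV ne connected_UNIV subset_UNIV])
      show "g z = f z" if "z \<in> {s. Re s > 13 / 2}" for z
        using f g that sums_unique2 unfolding is_ramanujan_L_def by blast
    qed (use f g in \<open>auto simp: is_ramanujan_L_def\<close>)
  qed
qed

definition euler_factor :: "complex ^ 'n ^ 'n \<Rightarrow> nat \<Rightarrow> complex \<Rightarrow> complex" where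
  "euler_factor A p s = inverse (det (mat 1 - mat (of_nat p powr (-s)) ** A))"

definition has_euler_product :: "(nat \<Rightarrow> complex ^ 'n ^ 'n) \<Rightarrow> complex \<Rightarrow> complex \<Rightarrow> bool" where
  "has_euler_product M s l \<longleftrightarrow>
     ((\<lambda>x::real. \<Prod>p | prime p \<and> real p \<le> x. euler_factor (M p) p s) \<longlongrightarrow> l) at_top"

text \<open>\<open>d\<close> is the order of the pole at \<open>s = 1\<close> of \<open>L(s,M)\<close>, negative in case of a zero (whereas
  \<open>zorder\<close> counts zeros positively). The number \<open>d\<close> does not depend
  on the choice of the continuation \<open>F\<close>, see \<open>euler_pole_order_at_1_unique\<close>.\<close>

definition euler_pole_order_at_1 :: "(nat \<Rightarrow> complex ^ 'n ^ 'n) \<Rightarrow> int \<Rightarrow> bool" where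
  "euler_pole_order_at_1 M d \<longleftrightarrow>
     (\<exists>F. F meromorphic_on insert 1 {s. Re s > 1} \<and>
          (\<forall>s. Re s > 1 \<longrightarrow> has_euler_product M s (F s)) \<and>
          zorder F 1 = -d)"

lemma euler_pole_order_at_1_unique:
  assumes "euler_pole_order_at_1 M d" "euler_pole_order_at_1 M d'"
  shows "d = d'"
proof -
  from assms obtain F G where
    F: "F meromorphic_on insert 1 {s. Re s > 1}" "zorder F 1 = -d" and
    G: "G meromorphic_on insert 1 {s. Re s > 1}" "zorder G 1 = -d'" and
    prods: "\<And>s. Re s > 1 \<Longrightarrow> has_euler_product M s (F s)" "\<And>s. Re s > 1 \<Longrightarrow> has_euler_product M s (G s)"
    unfolding euler_pole_order_at_1_def by blast
  have eq: "F s = G s" if "Re s > 1" for s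
    using prods[OF that] unfolding has_euler_product_def
    by (intro tendsto_unique[OF trivial_limit_at_top_linorder])
  have "(\<lambda>s. F s - G s) meromorphic_on {1}"
    by (intro meromorphic_intros meromorphic_on_subset[OF F(1)] meromorphic_on_subset[OF G(1)]) auto
  hence mero: "isolated_singularity_at (\<lambda>s. F s - G s) 1" "not_essential (\<lambda>s. F s - G s) 1"
    by (simp_all add: meromorphic_at_iff)
  have "\<exists>\<^sub>F s in at 1. F s - G s = 0"
    unfolding frequently_at
  proof (intro allI impI)
    fix e :: real assume "e > 0"
    thus "\<exists>s\<in>UNIV. s \<noteq> 1 \<and> dist s 1 < e \<and> F s - G s = 0"
      by (intro bexI[of _ "1 + of_real (e / 2)"]) (auto simp: dist_norm eq)
  qed
  from not_essential_frequently_0_imp_eventually_0[OF mero this]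
  have "\<forall>\<^sub>F s in at 1. F s = G s" by eventually_elim simp
  hence "zorder F 1 = zorder G 1" by (rule zorder_cong) simp
  with F G show ?thesis by simp
qed

text \<open>\<open>\<delta>(M)\<close> is formed from the squared matrices.\<close>

definition is_delta :: "(nat \<Rightarrow> complex ^ 'n ^ 'n) \<Rightarrow> int \<Rightarrow> bool" where
  "is_delta M d \<longleftrightarrow> euler_pole_order_at_1 (\<lambda>p. M p ** M p) d"

text \<open>That such angles exist is Deligne's bound \<open>\<bar>\<tau>(p)\<bar> \<le> 2 p\<^sup>1\<^sup>1\<^sup>/\<^sup>2\<close>. The values of \<open>\<theta>\<close> at
  non-primes are irrelevant.\<close>

definition is_ramanujan_angle :: "(nat \<Rightarrow> real) \<Rightarrow> bool" where
  "is_ramanujan_angle \<theta> \<longleftrightarrow>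
     (\<forall>p. prime p \<longrightarrow> \<theta> p \<in> {0..pi} \<and>
        real_of_int (ramanujan_tau p) = 2 * real p powr (11 / 2) * cos (\<theta> p))"

definition ramanujan_M :: "(nat \<Rightarrow> real) \<Rightarrow> nat \<Rightarrow> complex ^ 2 ^ 2" where
  "ramanujan_M \<theta> p = vector [vector [cis (\<theta> p), 0], vector [0, cis (- \<theta> p)]]"

lemma is_ramanujan_angle_unique:
  assumes "is_ramanujan_angle \<theta>" "is_ramanujan_angle \<theta>'" "prime p"
  shows "\<theta> p = \<theta>' p"
proof -
  have "real p powr (11 / 2) > 0" using prime_gt_0_nat[OF assms(3)] by simp
  hence "cos (\<theta> p) = cos (\<theta>' p)"
    using assms unfolding is_ramanujan_angle_def
    by (smt (verit) mult_cancel_left)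
  thus ?thesis
    using assms unfolding is_ramanujan_angle_def by (metis atLeastAtMost_iff cos_inj_pi)
qed

lemma euler_factor_ramanujan_M:
  assumes "p > 0"
  shows "euler_factor (ramanujan_M \<theta> p) p s =
     inverse (1 - 2 * of_real (cos (\<theta> p)) * of_nat p powr (-s) + of_nat p powr (-2 * s))"
proof -
  define y where "y = (of_nat p powr (-s) :: complex)"
  have y2: "of_nat p powr (-2 * s) = y * y"
    using assms by (simp add: y_def flip: powr_add)
  have c: "cis (\<theta> p) + cis (- \<theta> p) = 2 * of_real (cos (\<theta> p))"
    by (simp add: complex_eq_iff)
  have m: "cis (\<theta> p) * cis (- \<theta> p) = 1" by (simp add: cis_mult)
  have "det (mat 1 - mat y ** ramanujan_M \<theta> p) = (1 - y * cis (\<theta> p)) * (1 - y * cis (- \<theta> p))"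
    by (simp add: det_2 ramanujan_M_def mat_def matrix_matrix_mult_def sum_2)
  also have "\<dots> = 1 - y * (cis (\<theta> p) + cis (- \<theta> p)) + y * y * (cis (\<theta> p) * cis (- \<theta> p))"
    by algebra
  also have "\<dots> = 1 - 2 * of_real (cos (\<theta> p)) * y + y * y"
    unfolding c m by simp
  finally show ?thesis
    unfolding euler_factor_def y2 y_def[symmetric] by simp
qed

end

theory Submission
  imports Defs "HOL-Real_Asymp.Real_Asymp"
begin

text \<open>Write \<open>u = p powr - (1/2)\<close>. Since
  \<open>- ln (1 - 2 cos \<theta> u + u\<^sup>2) = 2 cos \<theta> u + cos (2 \<theta>) u\<^sup>2 + O(u\<^sup>3)\<close> and the logarithms of the partial
  Euler products are bounded, the sum in question is \<open>- (\<Sum>p\<le>x. cos (2 \<theta>(p)) / p) + O(1)\<close>.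
  Because \<open>L(s,M\<^sup>2)\<close> has a pole of order \<open>\<delta>\<close> at \<open>1\<close>, the Dirichlet series
  \<open>\<Sum>p. 2 cos (2 \<theta>(p)) p powr - (1 + e)\<close> is asymptotic to \<open>\<delta> ln (1/e)\<close> as \<open>e\<close> tends to \<open>0\<close>. A Tauberian argument
  for nonnegative coefficients, applied to \<open>2 cos (2 \<theta>(p)) + 2\<close> and to \<open>2\<close> (where the Dirichlet
  series is governed by the Euler product of the zeta function), turns this into
  \<open>(\<Sum>p\<le>x. 2 cos (2 \<theta>(p)) / p) \<sim> \<delta> ln (ln x)\<close>, with \<open>\<delta> = -1\<close>.\<close>

subsection \<open>The Euler product of the zeta function\<close>

text \<open>Zero is excluded by hand: its prime factorization is empty by convention, so the
  inclusion alone would admit it for every \<open>P\<close>.\<close>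

definition smooth_nats :: "nat set \<Rightarrow> nat set" where
  "smooth_nats P = {n. n > 0 \<and> prime_factors n \<subseteq> P}"

text \<open>Unique factorization: \<open>k\<close> is recovered as the multiplicity of
  \<open>p\<close>, because \<open>p\<close> does not divide the cofactor. This is the reindexing
  behind the induction step of the Euler product.\<close>

lemma smooth_nats_insert:
  assumes "prime p" "p \<notin> P"
  shows "bij_betw (\<lambda>(k, n). p ^ k * n) (UNIV \<times> smooth_nats P) (smooth_nats (insert p P))"
proof (rule bij_betwI')
  have ndvd: "\<not> p dvd n" if "n \<in> smooth_nats P" for n
    using that assms by (auto simp: smooth_nats_def in_prime_factors_iff)
  fix x y :: "nat \<times> nat" assume "x \<in> UNIV \<times> smooth_nats P" "y \<in> UNIV \<times> smooth_nats P"
  moreover have "k = l \<and> n = m"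
    if "n \<in> smooth_nats P" "m \<in> smooth_nats P" "p ^ k * n = p ^ l * m" for k l n m
  proof -
    have "p \<noteq> 0" using assms by auto
    then have "multiplicity p (p ^ k * n) = k" "multiplicity p (p ^ l * m) = l"
      using ndvd that by (metis multiplicity_decomposeI)+
    then show ?thesis using that(3) \<open>p \<noteq> 0\<close> by simp
  qed
  ultimately show "((case x of (k, n) \<Rightarrow> p ^ k * n) = (case y of (k, n) \<Rightarrow> p ^ k * n)) = (x = y)"
    by (auto split: prod.splits)
next
  fix x assume "x \<in> (UNIV :: nat set) \<times> smooth_nats P"
  then show "(case x of (k, n) \<Rightarrow> p ^ k * n) \<in> smooth_nats (insert p P)"
    using assms prime_gt_0_nat[of p]
    by (auto simp: smooth_nats_def in_prime_factors_iff prime_dvd_mult_iff subset_iff)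
       (metis prime_dvd_power primes_dvd_imp_eq)
next
  fix n assume n: "n \<in> smooth_nats (insert p P)"
  then have "n \<noteq> 0" by (simp add: smooth_nats_def)
  moreover have "\<not> is_unit p" using assms by auto
  ultimately obtain m where m: "n = p ^ multiplicity p n * m" "\<not> p dvd m"
    by (rule multiplicity_decompose')
  have "m \<in> smooth_nats P"
    unfolding smooth_nats_def
  proof safe
    show "m > 0" using m \<open>n \<noteq> 0\<close> by (cases m) auto
    fix q assume q: "q \<in># prime_factorization m"
    then have "q dvd m" "prime q" by (auto simp: in_prime_factors_iff)
    then have "q dvd n" "prime q" by (metis dvd_mult m(1), simp)
    then have "q \<in> insert p P"
      using n \<open>n \<noteq> 0\<close> by (auto simp: smooth_nats_def in_prime_factors_iff)
    then show "q \<in> P" using q m(2) by (auto simp: in_prime_factors_iff)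
  qed
  then show "\<exists>x\<in>UNIV \<times> smooth_nats P. n = (case x of (k, n) \<Rightarrow> p ^ k * n)"
    using m(1) by (intro bexI[of _ "(multiplicity p n, m)"]) auto
qed

text \<open>Induction over the primes: a new prime contributes a geometric series, which is
  multiplied with the sum obtained so far. Since \<open>has_sum\<close> is unordered, the resulting
  double sum can be rearranged along \<open>smooth_nats_insert\<close>.\<close>

lemma has_sum_smooth_nats:
  fixes s :: real
  assumes "finite P" "\<And>p. p \<in> P \<Longrightarrow> prime p" "s > 0"
  shows "((\<lambda>n. real n powr - s) has_sum (\<Prod>p\<in>P. inverse (1 - real p powr - s))) (smooth_nats P)"
  using assms(1,2)
proof (induction P rule: finite_induct)
  case empty
  have "smooth_nats {} = {1}"
    by (auto simp: smooth_nats_def prime_factorization_empty_iff)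
  then show ?case using has_sum_finite[of "{1::nat}" "\<lambda>n. real n powr - s"] by simp
next
  case (insert p P)
  define S where "S = (\<Prod>q\<in>P. inverse (1 - real q powr - s))"
  define u where "u = real p powr - s"
  have p: "prime p" "real p > 1" using insert.prems prime_gt_1_nat[of p] by auto
  then have u: "0 < u" "u < 1" using \<open>s > 0\<close> powr_less_cancel_iff[of "real p" "-s" 0] by (auto simp: u_def)
  have pow: "real (p ^ k) powr - s = u ^ k" for k
    using p by (simp add: u_def powr_realpow[symmetric] powr_powr powr_power mult.commute)
  have IH: "((\<lambda>n. real n powr - s) has_sum S) (smooth_nats P)"
    unfolding S_def using insert by blast
  have geo: "((\<lambda>k. u ^ k * S) has_sum (inverse (1 - u) * S)) UNIV"
  proof (rule has_sum_cmult_left, rule sums_nonneg_imp_has_sum)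
    show "(\<lambda>k. u ^ k) sums inverse (1 - u)"
      using geometric_sums[of u] u by (simp add: divide_inverse)
  qed (use u in auto)
  have "((\<lambda>(k, n). u ^ k * real n powr - s) has_sum (inverse (1 - u) * S)) (UNIV \<times> smooth_nats P)"
  proof (rule has_sum_SigmaI)
    show row: "((\<lambda>y. case (x, y) of (k, n) \<Rightarrow> u ^ k * real n powr - s) has_sum u ^ x * S) (smooth_nats P)"
      for x using has_sum_cmult_right[OF IH] by simp
    \<comment> \<open>Nonnegativity reduces joint summability to that of the rows and of the row
      sums \<open>u ^ k * S\<close>.\<close>
    show "(\<lambda>(k, n). u ^ k * real n powr - s) summable_on UNIV \<times> smooth_nats P"
      by (rule summable_on_SigmaI[OF row has_sum_imp_summable[OF geo]]) (use u in auto)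
  qed (rule geo)
  also have "(\<lambda>(k, n). u ^ k * real n powr - s) = (\<lambda>x. real (case x of (k, n) \<Rightarrow> p ^ k * n) powr - s)"
    by (auto simp: fun_eq_iff powr_mult pow simp del: of_nat_power)
  also have "(\<dots> has_sum inverse (1 - u) * S) (UNIV \<times> smooth_nats P) \<longleftrightarrow>
      ((\<lambda>n. real n powr - s) has_sum inverse (1 - u) * S) (smooth_nats (insert p P))"
    by (rule has_sum_reindex_bij_betw[OF smooth_nats_insert]) (use p insert in auto)
  finally show ?case using insert by (simp add: S_def u_def)
qed

text \<open>A discrete integral test: the mean value theorem for \<open>z powr - e\<close> on
  \<open>[n, n + 1]\<close> compares each term of zeta(1 + e) with a difference that
  telescopes.\<close>

lemma powr_telescope_bounds:
  fixes e :: real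
  assumes "e > 0" "n > 0"
  shows "real (Suc n) powr - (1 + e) \<le> (real n powr - e - real (Suc n) powr - e) / e"
    and "(real n powr - e - real (Suc n) powr - e) / e \<le> real n powr - (1 + e)"
proof -
  have "\<exists>z. real n < z \<and> z < real (Suc n) \<and>
      real (Suc n) powr - e - real n powr - e = (real (Suc n) - real n) * (- e * z powr (- e - 1))"
    by (rule MVT2) (use assms in \<open>auto intro!: derivative_eq_intros\<close>)
  then obtain z where z': "real n < z" "z < real (Suc n)"
      "real (Suc n) powr - e - real n powr - e = (real (Suc n) - real n) * (- e * z powr (- e - 1))"
    by blast
  have exponent: "- (1 + e) = - e - 1" by simp
  have z: "real n < z" "z < real (Suc n)"
    "(real n powr - e - real (Suc n) powr - e) / e = z powr - (1 + e)"
    using z' assms unfolding exponent by (simp_all add: divide_eq_eq mult.commute)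
  show "real (Suc n) powr - (1 + e) \<le> (real n powr - e - real (Suc n) powr - e) / e"
    unfolding z(3) using z assms by (intro powr_mono2') auto
  show "(real n powr - e - real (Suc n) powr - e) / e \<le> real n powr - (1 + e)"
    unfolding z(3) using z assms by (intro powr_mono2') auto
qed

lemma sum_powr_lower:
  assumes "e > (0::real)"
  shows "(1 - real (Suc N) powr - e) / e \<le> (\<Sum>n=1..N. real n powr - (1 + e))"
proof (induction N)
  case (Suc N)
  then show ?case
    using powr_telescope_bounds(2)[OF assms, of "Suc N"] assms by (simp add: field_simps)
qed simp

lemma sum_powr_upper:
  assumes "e > (0::real)"
  shows "(\<Sum>n=1..Suc N. real n powr - (1 + e)) \<le> 1 + (1 - real (Suc N) powr - e) / e"
proof (induction N)
  case (Suc N)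
  then show ?case
    using powr_telescope_bounds(1)[OF assms, of "Suc N"] assms by (simp add: field_simps)
qed simp

text \<open>Every positive \<open>n \<le> N\<close> has only prime factors up to \<open>N\<close>,
  so the product dominates a partial sum of zeta(1 + e). Conversely it is a sum over a set of
  positive integers, hence at most the bound for the whole zeta series. Together these give the size
  1/e near the pole.\<close>

lemma prime_product_bounds:
  fixes e :: real and N :: nat
  assumes "e > 0"
  defines "E \<equiv> \<Prod>p | prime p \<and> p \<le> N. inverse (1 - real p powr - (1 + e))"
  shows "(1 - real (Suc N) powr - e) / e \<le> E" "E \<le> 1 + 1 / e"
proof -
  let ?P = "{p. prime p \<and> p \<le> N}" and ?f = "\<lambda>n::nat. real n powr - (1 + e)"
  have hs: "(?f has_sum E) (smooth_nats ?P)"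
    unfolding E_def by (rule has_sum_smooth_nats) (use assms in auto)
  have "(?f has_sum (\<Sum>n=1..N. ?f n)) {1..N}" by simp
  then have "(\<Sum>n=1..N. ?f n) \<le> E"
    by (rule has_sum_mono2[OF _ hs])
       (auto simp: smooth_nats_def in_prime_factors_iff intro: order_trans[OF dvd_imp_le])
  then show "(1 - real (Suc N) powr - e) / e \<le> E"
    using sum_powr_lower[OF assms(1), of N] by linarith
  show "E \<le> 1 + 1 / e"
  proof (rule has_sum_le_finite_sums[OF hs])
    fix F assume F: "finite F" "F \<subseteq> smooth_nats ?P"
    \<comment> \<open>This \<open>N\<close> bounds the finite set \<open>F\<close> and shadows the
      cutoff for the primes.\<close>
    then obtain N where "\<forall>n\<in>F. n \<le> N" using finite_nat_set_iff_bounded_le by blast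
    then have "sum ?f F \<le> (\<Sum>n=1..Suc N. ?f n)"
      using F by (intro sum_mono2) (force simp: smooth_nats_def)+
    also have "\<dots> \<le> 1 + (1 - real (Suc N) powr - e) / e"
      by (rule sum_powr_upper[OF assms(1)])
    also have "\<dots> \<le> 1 + 1 / e"
      using assms by (simp add: divide_right_mono)
    finally show "sum ?f F \<le> 1 + 1 / e" .
  qed
qed

subsection \<open>A Tauberian lemma\<close>

lemma finite_real_le: "finite {n. real n \<le> x}"
  by (rule finite_subset[of _ "{..nat \<lceil>x\<rceil>}"]) (auto, linarith)

text \<open>Since \<open>x powr (1 / ln x) = exp 1\<close>, damping by \<open>n powr (- K / ln x)\<close> costs at most a factor
  \<open>exp (- K)\<close> on \<open>n \<le> x\<close> and gains at least \<open>exp (- K / 2)\<close> over half the damping on \<open>n > x\<close>;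
  replacing \<open>ln x\<close> by \<open>ln x / K\<close> does not affect \<open>ln (ln x)\<close> asymptotically.\<close>

lemma tauberian_ln:
  fixes a :: "nat \<Rightarrow> real" and l :: real
  assumes nonneg: "\<And>n. a n \<ge> 0" and a0: "a 0 = 0"
    and summ: "\<And>e. e > 0 \<Longrightarrow> summable (\<lambda>n. a n * real n powr - e)"
    and lim: "((\<lambda>e. (\<Sum>n. a n * real n powr - e) / ln (1 / e)) \<longlongrightarrow> l) (at_right 0)"
  shows "((\<lambda>x. (\<Sum>n | real n \<le> x. a n) / ln (ln x)) \<longlongrightarrow> l) at_top"
proof -
  define f where "f e = (\<Sum>n. a n * real n powr - e)" for e
  define A where "A x = (\<Sum>n | real n \<le> x. a n)" for x
  have f_sums: "(\<lambda>n. a n * real n powr - e) sums f e" if "e > 0" for e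
    using summ[OF that] by (simp add: f_def summable_sums)
  have upper: "A x \<le> exp K * f (K / ln x)" if "K > 0" "x > 1" for K x :: real
  proof -
    define e where "e = K / ln x"
    have e: "e > 0" "e * ln x = K" using that by (simp_all add: e_def)
    have "A x \<le> (\<Sum>n | real n \<le> x. exp K * (a n * real n powr - e))"
      unfolding A_def
    proof (rule sum_mono)
      fix n assume n: "n \<in> {n. real n \<le> x}"
      show "a n \<le> exp K * (a n * real n powr - e)"
      \<comment> \<open>By convention \<open>0 powr - e\<close> is 0, so the damped term at 0
        vanishes and the inequality there rests on \<open>a 0 = 0\<close>.\<close>
      proof (cases "n = 0")
        case False
        have "e * ln (real n) \<le> e * ln x" using n False e by (intro mult_left_mono) auto
        then have "exp (- K) \<le> real n powr - e" using False e by (simp add: powr_def)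
        then have "exp K * exp (- K) * a n \<le> exp K * real n powr - e * a n"
          by (intro mult_right_mono nonneg mult_left_mono) auto
        then show ?thesis by (simp add: exp_minus_inverse mult_ac)
      qed (simp add: a0)
    qed
    also have "\<dots> \<le> exp K * f e"
      unfolding sum_distrib_left[symmetric] f_def
      by (intro mult_left_mono sum_le_suminf finite_real_le summ e) (auto intro!: mult_nonneg_nonneg nonneg)
    finally show ?thesis by (simp add: e_def)
  qed
  have lower: "f (K / ln x) - exp (- (K / 2)) * f (K / 2 / ln x) \<le> A x" if "K > 0" "x > 1" for K x :: real
  proof -
    define e where "e = K / ln x"
    have e: "e > 0" "e * ln x = K" using that by (simp_all add: e_def)
    have s: "(\<lambda>n. a n * real n powr - e - exp (- (K / 2)) * (a n * real n powr - (e / 2)))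
        sums (f e - exp (- (K / 2)) * f (e / 2))"
      by (intro sums_diff sums_mult f_sums) (use e in auto)
    have "(\<lambda>n. if n \<in> {n. real n \<le> x} then a n else 0) sums A x"
      unfolding A_def by (rule sums_If_finite_set[OF finite_real_le])
    with s have "f e - exp (- (K / 2)) * f (e / 2) \<le> A x"
    proof (rule sums_le[rotated])
      fix n
      show "a n * real n powr - e - exp (- (K / 2)) * (a n * real n powr - (e / 2))
          \<le> (if n \<in> {n. real n \<le> x} then a n else 0)"
      proof (cases "real n \<le> x")
        case True
        have "a n * real n powr - e \<le> a n * 1"
        proof (cases "n = 0")
          case False
          then have "real n powr - e \<le> real n powr 0"
            using e by (intro powr_mono) auto
          then show ?thesis using False by (intro mult_left_mono nonneg) simp
        qed (simp add: a0)
        moreover have "exp (- (K / 2)) * (a n * real n powr - (e / 2)) \<ge> 0" using nonneg by simp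
        ultimately show ?thesis using True by auto
      next
        case False
        then have n: "real n > x" "n > 0" using that by auto
        have "(e / 2) * ln x \<le> (e / 2) * ln (real n)"
          using n e that by (intro mult_left_mono) auto
        then have "real n powr - (e / 2) \<le> exp (- (K / 2))"
          using n e by (simp add: powr_def)
        then have "a n * real n powr - (e / 2) * real n powr - (e / 2)
            \<le> a n * real n powr - (e / 2) * exp (- (K / 2))"
          by (intro mult_left_mono) (auto intro!: mult_nonneg_nonneg nonneg)
        moreover have "real n powr - (e / 2) * real n powr - (e / 2) = real n powr - e"
          by (simp flip: powr_add)
        ultimately show ?thesis using False by (simp add: mult_ac)
      qed
    qed
    then show ?thesis by (simp add: e_def mult.commute)
  qed
  have flim: "((\<lambda>x. f (K / ln x) / ln (ln x)) \<longlongrightarrow> l) at_top" if "K > 0" for K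
  proof -
    have 1: "filterlim (\<lambda>x. K / ln x) (at_right 0) at_top" using that by real_asymp
    have "((\<lambda>x. f (K / ln x) / ln (1 / (K / ln x)) * (ln (1 / (K / ln x)) / ln (ln x))) \<longlongrightarrow> l * 1) at_top"
    proof (rule tendsto_mult)
      show "((\<lambda>x. f (K / ln x) / ln (1 / (K / ln x))) \<longlongrightarrow> l) at_top"
        using filterlim_compose[OF lim 1] by (simp add: f_def)
      show "((\<lambda>x. ln (1 / (K / ln x)) / ln (ln x)) \<longlongrightarrow> 1) at_top"
        using that by real_asymp
    qed
    moreover have "\<forall>\<^sub>F x in at_top. ln (1 / (K / ln x)) > 0"
      using that by real_asymp
    then have "\<forall>\<^sub>F x in at_top. f (K / ln x) / ln (1 / (K / ln x)) * (ln (1 / (K / ln x)) / ln (ln x))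
        = f (K / ln x) / ln (ln x)"
      by eventually_elim simp
    ultimately show ?thesis using Lim_transform_eventually by force
  qed
  have ev: "\<forall>\<^sub>F x::real in at_top. x > 1 \<and> ln (ln x) > 0"
    by (intro eventually_conj; real_asymp)
  show ?thesis
    unfolding A_def[symmetric]
  proof (rule order_tendstoI)
    fix u assume "l < u"
    \<comment> \<open>For the upper bound \<open>K\<close> is taken small, so that the loss
      \<open>exp K\<close> is close to 1.\<close>
    have "((\<lambda>K. exp K * l) \<longlongrightarrow> exp 0 * l) (at_right 0)" by (intro tendsto_intros)
    then have "\<forall>\<^sub>F K in at_right 0. exp K * l < u \<and> K > 0"
      using \<open>l < u\<close> by (intro eventually_conj order_tendstoD(2) eventually_at_right_less) auto
    then obtain K where K: "exp K * l < u" "K > 0"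
      using eventually_happens trivial_limit_at_right_real by blast
    have "((\<lambda>x. exp K * (f (K / ln x) / ln (ln x))) \<longlongrightarrow> exp K * l) at_top"
      by (intro tendsto_intros flim K)
    then have "\<forall>\<^sub>F x in at_top. exp K * (f (K / ln x) / ln (ln x)) < u"
      using K by (intro order_tendstoD)
    with ev show "\<forall>\<^sub>F x in at_top. A x / ln (ln x) < u"
    proof eventually_elim
      case (elim x)
      then show ?case using divide_right_mono[OF upper[of K x], of "ln (ln x)"] K by auto
    qed
  next
    fix u assume "u < l"
    \<comment> \<open>For the lower bound \<open>K\<close> is taken large, so that the subtracted
      tail contribution becomes negligible.\<close>
    have "((\<lambda>K. l - exp (- (K / 2)) * l) \<longlongrightarrow> l - 0 * l) at_top"
      by (intro tendsto_intros) real_asymp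
    then have "\<forall>\<^sub>F K in at_top. u < l - exp (- (K / 2)) * l \<and> K > 0"
      using \<open>u < l\<close> by (intro eventually_conj order_tendstoD(1) eventually_gt_at_top) auto
    then obtain K where K: "u < l - exp (- (K / 2)) * l" "K > 0"
      using eventually_happens trivial_limit_at_top_linorder by blast
    have "((\<lambda>x. f (K / ln x) / ln (ln x) - exp (- (K / 2)) * (f (K / 2 / ln x) / ln (ln x)))
        \<longlongrightarrow> l - exp (- (K / 2)) * l) at_top"
      by (intro tendsto_intros flim) (use K in auto)
    then have "\<forall>\<^sub>F x in at_top. u < f (K / ln x) / ln (ln x) - exp (- (K / 2)) * (f (K / 2 / ln x) / ln (ln x))"
      using K by (intro order_tendstoD)
    with ev show "\<forall>\<^sub>F x in at_top. u < A x / ln (ln x)"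
    proof eventually_elim
      case (elim x)
      then show ?case using divide_right_mono[OF lower[of K x], of "ln (ln x)"] K
        by (auto simp: diff_divide_distrib)
    qed
  qed
qed

subsection \<open>Logarithms of Euler products\<close>

text \<open>The function inside the absolute value vanishes at 0 and has derivative
  \<open>x\<^sup>2 / (1 + x)\<close>, so the mean value theorem yields a cubic bound. The threshold
  1/16 is \<open>(1 - 3/4)\<^sup>2\<close>, the least value of the local quadratic factor when
  \<open>u \<le> 3/4\<close>.\<close>

lemma ln_one_plus_cubic_bound:
  fixes w :: real
  assumes "1 + w \<ge> 1 / 16"
  shows "\<bar>ln (1 + w) - w + w\<^sup>2 / 2\<bar> \<le> 16 * \<bar>w\<bar> ^ 3"
proof -
  define g where "g x = ln (1 + x) - x + x\<^sup>2 / 2" for x :: real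
  have g0: "g 0 = 0" by (simp add: g_def)
  have deriv: "(g has_real_derivative x\<^sup>2 / (1 + x)) (at x)" if "1 + x > 0" for x
    unfolding g_def using that
    by (auto intro!: derivative_eq_intros simp: field_simps power2_eq_square)
  have "\<exists>z. \<bar>z\<bar> \<le> \<bar>w\<bar> \<and> 1 + z \<ge> 1 / 16 \<and> g w = w * (z\<^sup>2 / (1 + z))"
  proof (rule linorder_cases[of w 0])
    assume w: "w < 0"
    have "\<exists>z. w < z \<and> z < 0 \<and> g 0 - g w = (0 - w) * (z\<^sup>2 / (1 + z))"
      by (rule MVT2) (use w assms in \<open>auto intro!: deriv\<close>)
    then obtain z where z: "w < z" "z < 0" "g 0 - g w = (0 - w) * (z\<^sup>2 / (1 + z))" by blast
    then have "g w = w * (z\<^sup>2 / (1 + z))" using g0 by simp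
    then show ?thesis using w z assms by (intro exI[of _ z]) auto
  next
    assume w: "w > 0"
    have "\<exists>z. 0 < z \<and> z < w \<and> g w - g 0 = (w - 0) * (z\<^sup>2 / (1 + z))"
      by (rule MVT2) (use w assms in \<open>auto intro!: deriv\<close>)
    then obtain z where z: "0 < z" "z < w" "g w - g 0 = (w - 0) * (z\<^sup>2 / (1 + z))" by blast
    then show ?thesis using w assms g0 by (intro exI[of _ z]) auto
  qed (auto simp: g0)
  then obtain z where z: "\<bar>z\<bar> \<le> \<bar>w\<bar>" "1 + z \<ge> 1 / 16" "g w = w * (z\<^sup>2 / (1 + z))" by blast
  have "z\<^sup>2 / (1 + z) \<le> w\<^sup>2 / (1 / 16)"
    using z by (intro frac_le) (auto simp: abs_le_square_iff)
  then have "\<bar>w\<bar> * (z\<^sup>2 / (1 + z)) \<le> \<bar>w\<bar> * (16 * w\<^sup>2)"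
    by (intro mult_left_mono) auto
  then show ?thesis
    using z by (simp add: g_def abs_mult power3_eq_cube power2_eq_square)
qed

text \<open>The logarithm of the local Euler factor at \<open>u = p powr - s\<close> for a matrix
  with eigenvalues \<open>cis t\<close> and \<open>cis (- t)\<close>.\<close>

definition log_factor :: "real \<Rightarrow> real \<Rightarrow> real" where
  "log_factor t u = - ln (1 - 2 * cos t * u + u\<^sup>2)"

lemma euler_quadratic_ge:
  fixes u :: real
  assumes "0 \<le> u"
  shows "1 - 2 * cos t * u + u\<^sup>2 \<ge> (1 - u)\<^sup>2"
  using mult_right_mono[OF cos_le_one[of t] assms] by (simp add: power2_eq_square algebra_simps)

text \<open>Put \<open>w = u\<^sup>2 - 2 * cos t * u\<close> in the expansion of
  \<open>ln (1 + w)\<close>; the terms of order two combine to \<open>cos (2 * t)\<close> by the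
  double angle formula. The remainder costs 16 * 27 from \<open>\<bar>w\<bar> \<le> 3 * u\<close>,
  and 1/2 + 2 from the terms of \<open>w\<^sup>2 / 2\<close> beyond order two, which is below
  500.\<close>

lemma log_factor_cubic_bound:
  assumes "0 \<le> u" "u \<le> 3 / 4"
  shows "\<bar>log_factor t u - 2 * cos t * u - cos (2 * t) * u\<^sup>2\<bar> \<le> 500 * u ^ 3"
proof -
  define w where "w = u\<^sup>2 - 2 * cos t * u"
  have "(1 - u)\<^sup>2 \<ge> (1 / 4)\<^sup>2" using assms by (intro power_mono) auto
  then have "1 + w \<ge> 1 / 16"
    using euler_quadratic_ge[OF assms(1), of t] by (simp add: w_def power2_eq_square)
  note b = ln_one_plus_cubic_bound[OF this]
  have cu: "\<bar>cos t * u\<bar> \<le> u"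
    using mult_right_mono[OF abs_cos_le_one[of t] assms(1)] assms by (simp add: abs_mult)
  have u2: "u\<^sup>2 \<le> u" using mult_left_mono[of u 1 u] assms by (simp add: power2_eq_square)
  have "\<bar>w\<bar> \<le> 3 * u" unfolding w_def using cu u2 assms zero_le_power2[of u] by linarith
  then have "\<bar>w\<bar> ^ 3 \<le> (3 * u) ^ 3" by (intro power_mono) auto
  then have w3: "\<bar>w\<bar> ^ 3 \<le> 27 * u ^ 3" by (simp add: power_mult_distrib)
  have "log_factor t u - 2 * cos t * u - cos (2 * t) * u\<^sup>2
      = - (ln (1 + w) - w + w\<^sup>2 / 2) + (u ^ 4 / 2 - 2 * (cos t * u) * u\<^sup>2)"
    unfolding log_factor_def cos_double_cos w_def
    by (simp add: field_simps power2_eq_square power4_eq_xxxx)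
  moreover have "u ^ 4 \<le> u ^ 3" using assms by (intro power_decreasing) auto
  moreover have "\<bar>(cos t * u) * u\<^sup>2\<bar> \<le> u ^ 3"
    using mult_right_mono[OF cu, of "u\<^sup>2"] assms by (simp add: abs_mult power3_eq_cube power2_eq_square)
  moreover have "u ^ 4 \<ge> 0" by simp
  ultimately show ?thesis using b w3 assms by (simp only: abs_le_iff) linarith
qed

lemma log_factor_quadratic_bound:
  assumes "0 \<le> u" "u \<le> 3 / 4"
  shows "\<bar>log_factor t u - 2 * cos t * u\<bar> \<le> 501 * u\<^sup>2"
proof -
  have "\<bar>cos (2 * t) * u\<^sup>2\<bar> \<le> u\<^sup>2"
    using mult_right_mono[OF abs_cos_le_one[of "2 * t"], of "u\<^sup>2"] by (simp add: abs_mult)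
  moreover have "u ^ 3 \<le> u ^ 2" using assms by (intro power_decreasing) auto
  ultimately show ?thesis using log_factor_cubic_bound[OF assms, of t] by linarith
qed

text \<open>The weight \<open>1 / n\<close> sits in the coefficient, so that damping by
  \<open>n powr - e\<close> gives the Dirichlet series at 1 + e while the undamped partial sums are
  those of the Tauberian lemma.\<close>

definition prime_term :: "(nat \<Rightarrow> real) \<Rightarrow> nat \<Rightarrow> real" where
  "prime_term t n = (if prime n then 2 * cos (t n) / real n else 0)"

definition log_term :: "(nat \<Rightarrow> real) \<Rightarrow> real \<Rightarrow> nat \<Rightarrow> real" where
  "log_term t s n = (if prime n then log_factor (t n) (real n powr - s) else 0)"

text \<open>The worst case is \<open>p = 2\<close>, \<open>s = 1/2\<close>, with value
  \<open>1 / sqrt 2\<close>; hence the expansions for \<open>u \<le> 3/4\<close> apply to every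
  prime, even on the critical line.\<close>

lemma prime_powr_le:
  assumes "prime p" "s \<ge> 1 / 2"
  shows "real p powr - s \<le> 3 / 4"
proof -
  have p: "real p \<ge> 2" using prime_ge_2_nat[OF assms(1)] by simp
  have "real p powr - s \<le> real p powr - (1 / 2)" using p assms by (intro powr_mono) auto
  also have "\<dots> \<le> 2 powr - (1 / 2)" using p by (intro powr_mono2') auto
  also have "\<dots> = 1 / sqrt 2" using powr_minus_divide[of 2 "1 / 2 :: real"] by (simp only: powr_half_sqrt)
  also have "\<dots> \<le> 3 / 4"
  proof -
    have "4 / 3 \<le> sqrt 2" by (rule real_le_rsqrt) (simp add: power2_eq_square)
    then show ?thesis by (simp add: field_simps)
  qed
  finally show ?thesis .
qed

section \<open>Dirichlet series over the primes to the right of 1\<close>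

lemma powr_minus_power2: "(x powr - s)\<^sup>2 = x powr - (2 * s)" for x s :: real
  by (simp add: power2_eq_square flip: powr_add)

lemma powr_minus_one_plus: "x \<ge> 0 \<Longrightarrow> x powr - (1 + e) = x powr - e / x" for x e :: real
proof -
  assume "x \<ge> 0"
  have "- (1 + e) = - e - 1" by simp
  with \<open>x \<ge> 0\<close> show ?thesis by (simp only: powr_diff powr_one)
qed

lemma summable_prime_term:
  assumes "e > 0"
  shows "summable (\<lambda>n. prime_term t n * real n powr - e)"
proof (rule summable_comparison_test')
  show "summable (\<lambda>n. 2 * real n powr - (1 + e))"
    using assms by (intro summable_mult) (simp add: summable_real_powr_iff)
  fix n :: nat
  have "\<bar>cos (t n)\<bar> * real n powr - (1 + e) \<le> 1 * real n powr - (1 + e)"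
    by (intro mult_right_mono) auto
  then show "norm (prime_term t n * real n powr - e) \<le> 2 * real n powr - (1 + e)"
    by (simp add: prime_term_def abs_mult powr_minus_one_plus del: minus_add_distrib)
qed

text \<open>The quadratic remainder is of size \<open>n powr - (2 * (1 + e))\<close>, hence at most
  a multiple of \<open>n powr - 2\<close>. The majorant does not depend on \<open>e\<close>, so its
  sum is a bounded error as \<open>e\<close> tends to 0.\<close>

lemma log_term_bound:
  assumes "e > 0"
  shows "\<bar>log_term t (1 + e) n - prime_term t n * real n powr - e\<bar> \<le> 501 * real n powr - 2"
proof (cases "prime n")
  case True
  then have n: "real n \<ge> 1" using prime_ge_1_nat[OF True] by simp
  define u where "u = real n powr - (1 + e)"
  have "prime_term t n * real n powr - e = 2 * cos (t n) * u"
    using True n by (simp add: prime_term_def u_def powr_minus_one_plus del: minus_add_distrib)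
  moreover have "u\<^sup>2 \<le> real n powr - 2"
    unfolding u_def powr_minus_power2 using n assms by (intro powr_mono) auto
  moreover have "\<bar>log_factor (t n) u - 2 * cos (t n) * u\<bar> \<le> 501 * u\<^sup>2"
    by (rule log_factor_quadratic_bound)
       (use prime_powr_le[OF True, of "1 + e"] assms in \<open>auto simp: u_def\<close>)
  ultimately show ?thesis using True by (simp add: log_term_def u_def)
qed (simp add: log_term_def prime_term_def)

lemma summable_powr_minus_2: "summable (\<lambda>n. 501 * real n powr - 2)"
  by (intro summable_mult) (simp add: summable_real_powr_iff)

lemma summable_log_term:
  assumes "e > 0"
  shows "summable (log_term t (1 + e))"
proof -
  have "summable (\<lambda>n. log_term t (1 + e) n - prime_term t n * real n powr - e)"
    by (rule summable_comparison_test'[OF summable_powr_minus_2]) (use log_term_bound[OF assms] in auto)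
  from summable_add[OF this summable_prime_term[OF assms, of t]] show ?thesis by simp
qed

lemma suminf_log_term_bound:
  assumes "e > 0"
  shows "\<bar>(\<Sum>n. log_term t (1 + e) n) - (\<Sum>n. prime_term t n * real n powr - e)\<bar>
    \<le> (\<Sum>n. 501 * real n powr - 2)"
  unfolding suminf_diff[OF summable_log_term[OF assms] summable_prime_term[OF assms]]
    real_norm_def[symmetric]
  by (rule norm_suminf_le[OF _ summable_powr_minus_2]) (use log_term_bound[OF assms] in auto)

text \<open>For \<open>s \<ge> 1/2\<close> each quadratic factor is at least
  \<open>(1 - real p powr - s)\<^sup>2 > 0\<close>, so \<open>exp\<close> undoes the
  logarithm.\<close>

lemma exp_sum_log_term:
  assumes "finite A" "s \<ge> 1 / 2"
  shows "exp (\<Sum>n\<in>A. log_term t s n) =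
    (\<Prod>p\<in>{p\<in>A. prime p}. inverse (1 - 2 * cos (t p) * real p powr - s + (real p powr - s)\<^sup>2))"
proof -
  have "(\<Sum>n\<in>A. log_term t s n) = (\<Sum>n\<in>{p\<in>A. prime p}. log_factor (t n) (real n powr - s))"
    using assms by (simp add: log_term_def sum.inter_filter)
  also have "exp \<dots> = (\<Prod>n\<in>{p\<in>A. prime p}. exp (log_factor (t n) (real n powr - s)))"
    using assms by (intro exp_sum) auto
  also have "\<dots> = (\<Prod>p\<in>{p\<in>A. prime p}. inverse (1 - 2 * cos (t p) * real p powr - s + (real p powr - s)\<^sup>2))"
  proof (intro prod.cong refl)
    fix p assume p: "p \<in> {p\<in>A. prime p}"
    then have "real p powr - s \<le> 3 / 4" using prime_powr_le assms by auto
    then have "0 < (1 - real p powr - s)\<^sup>2" by simp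
    also have "\<dots> \<le> 1 - 2 * cos (t p) * real p powr - s + (real p powr - s)\<^sup>2"
      by (rule euler_quadratic_ge) simp
    finally show "exp (log_factor (t p) (real p powr - s)) =
        inverse (1 - 2 * cos (t p) * real p powr - s + (real p powr - s)\<^sup>2)"
      by (simp add: log_factor_def exp_minus)
  qed
  finally show ?thesis .
qed

section \<open>Logarithmic growth at 1 and its transfer to partial sums\<close>

lemma prime_term_limit_if_log_term_limit:
  assumes "((\<lambda>e. (\<Sum>n. log_term t (1 + e) n) / ln (1 / e)) \<longlongrightarrow> l) (at_right 0)"
  shows "((\<lambda>e. (\<Sum>n. prime_term t n * real n powr - e) / ln (1 / e)) \<longlongrightarrow> l) (at_right 0)"
proof -
  define C :: real where "C = (\<Sum>n. 501 * real n powr - 2)"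
  let ?d = "\<lambda>e. ((\<Sum>n. log_term t (1 + e) n) - (\<Sum>n. prime_term t n * real n powr - e)) / ln (1 / e)"
  have "(?d \<longlongrightarrow> 0) (at_right 0)"
  proof (rule Lim_null_comparison)
    \<comment> \<open>The two series differ by at most \<open>C\<close> uniformly in
      \<open>e\<close>, which disappears against \<open>ln (1 / e)\<close>.\<close>
    show "((\<lambda>e. C / ln (1 / e)) \<longlongrightarrow> 0) (at_right 0)" by real_asymp
    have "\<forall>\<^sub>F e::real in at_right 0. e > 0 \<and> ln (1 / e) > 0"
      by (intro eventually_conj; real_asymp)
    then show "\<forall>\<^sub>F e in at_right 0. norm (?d e) \<le> C / ln (1 / e)"
    proof eventually_elim
      case (elim e)
      then have pos: "e > 0" "ln (1 / e) > 0" by auto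
      show ?case
        unfolding real_norm_def abs_divide abs_of_pos[OF pos(2)] C_def
        by (intro divide_right_mono suminf_log_term_bound less_imp_le pos)
    qed
  qed
  from tendsto_diff[OF assms this] show ?thesis by (simp add: diff_divide_distrib)
qed

text \<open>At angle 0 both eigenvalues are 1 and the Euler product is the square of zeta(1 + e). As
  zeta(1 + e) lies between 1/e and 1 + 1/e, the limit is 2.\<close>

lemma log_zeta_limit:
  "((\<lambda>e. (\<Sum>n. log_term (\<lambda>_. 0) (1 + e) n) / ln (1 / e)) \<longlongrightarrow> 2) (at_right 0)"
proof -
  define L where "L e = (\<Sum>n. log_term (\<lambda>_. 0) (1 + e) n)" for e
  have bounds: "2 * ln (1 / e) \<le> L e" "L e \<le> 2 * ln (1 + 1 / e)" if "e > 0" for e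
  proof -
    define E where "E N = (\<Prod>p | prime p \<and> p \<le> N. inverse (1 - real p powr - (1 + e)))" for N :: nat
    have square: "inverse (1 - 2 * cos 0 * u + u\<^sup>2) = (inverse (1 - u))\<^sup>2" for u :: real
      unfolding power_inverse by (simp add: power2_diff)
    have eq: "exp (\<Sum>n\<le>N. log_term (\<lambda>_. 0) (1 + e) n) = (E N)\<^sup>2" for N
    proof -
      have "exp (\<Sum>n\<le>N. log_term (\<lambda>_. 0) (1 + e) n) =
          (\<Prod>p\<in>{p\<in>{..N}. prime p}. (inverse (1 - real p powr - (1 + e)))\<^sup>2)"
        using that unfolding square[symmetric] by (intro exp_sum_log_term) auto
      also have "\<dots> = (E N)\<^sup>2"
        unfolding E_def prod_power_distrib by (intro arg_cong[where f = "\<lambda>x. x\<^sup>2"] prod.cong) auto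
      finally show ?thesis .
    qed
    have "(\<lambda>N. \<Sum>n\<le>N. log_term (\<lambda>_. 0) (1 + e) n) \<longlonglongrightarrow> L e"
      using summable_LIMSEQ'[OF summable_log_term[OF that]] by (simp add: L_def)
    then have lim: "(\<lambda>N. (E N)\<^sup>2) \<longlonglongrightarrow> exp (L e)"
      unfolding eq[symmetric] by (rule tendsto_exp)
    have "(\<lambda>N. ((1 - real (Suc N) powr - e) / e)\<^sup>2) \<longlonglongrightarrow> ((1 - 0) / e)\<^sup>2"
      using that by (intro tendsto_intros) (auto, real_asymp)
    moreover have "\<exists>N0. \<forall>N\<ge>N0. ((1 - real (Suc N) powr - e) / e)\<^sup>2 \<le> (E N)\<^sup>2"
    proof (intro exI allI impI power_mono)
      fix N
      show "(1 - real (Suc N) powr - e) / e \<le> E N"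
        unfolding E_def by (rule prime_product_bounds[OF that])
      show "0 \<le> (1 - real (Suc N) powr - e) / e"
        using that powr_mono[of "-e" 0 "real (Suc N)"] by simp
    qed
    ultimately have le: "((1 - 0) / e)\<^sup>2 \<le> exp (L e)"
      using lim by (intro LIMSEQ_le)
    have "2 * ln (1 / e) = ln (((1 - 0) / e)\<^sup>2)"
      using that by (simp add: ln_realpow)
    also have "\<dots> \<le> ln (exp (L e))" using le that by (intro ln_mono) auto
    finally show "2 * ln (1 / e) \<le> L e" by simp
    have "0 \<le> E N" for N
    proof -
      have "0 \<le> (1 - real (Suc N) powr - e) / e"
        using that powr_mono[of "-e" 0 "real (Suc N)"] by simp
      then show ?thesis using prime_product_bounds(1)[OF that, of N] unfolding E_def by linarith
    qed
    then have "(E N)\<^sup>2 \<le> (1 + 1 / e)\<^sup>2" for N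
      using prime_product_bounds(2)[OF that, of N] by (intro power_mono) (auto simp: E_def)
    then have "exp (L e) \<le> (1 + 1 / e)\<^sup>2"
      by (intro LIMSEQ_le_const2[OF lim]) auto
    then have "ln (exp (L e)) \<le> ln ((1 + 1 / e)\<^sup>2)" by (intro ln_mono) auto
    also have "\<dots> = 2 * ln (1 + 1 / e)"
      using that by (simp add: ln_realpow add_pos_pos)
    finally show "L e \<le> 2 * ln (1 + 1 / e)" by simp
  qed
  have ev: "\<forall>\<^sub>F e::real in at_right 0. e > 0 \<and> ln (1 / e) > 0"
    by (intro eventually_conj; real_asymp)
  show ?thesis
    unfolding L_def[symmetric]
  proof (rule tendsto_sandwich)
    show "\<forall>\<^sub>F e in at_right 0. 2 * ln (1 / e) / ln (1 / e) \<le> L e / ln (1 / e)"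
      using ev by eventually_elim (intro divide_right_mono bounds, auto)
    show "\<forall>\<^sub>F e in at_right 0. L e / ln (1 / e) \<le> 2 * ln (1 + 1 / e) / ln (1 / e)"
      using ev by eventually_elim (intro divide_right_mono bounds, auto)
    show "((\<lambda>e. 2 * ln (1 / e) / ln (1 / e)) \<longlongrightarrow> 2) (at_right (0::real))" by real_asymp
    show "((\<lambda>e. 2 * ln (1 + 1 / e) / ln (1 / e)) \<longlongrightarrow> 2) (at_right (0::real))" by real_asymp
  qed
qed

text \<open>The coefficients may be negative, so the Tauberian lemma is applied to their sum with
  the angle 0 coefficients, with limit \<open>l + 2\<close>, and to the latter alone, with limit 2;
  the difference is the claim.\<close>

lemma prime_term_partial_sums_limit:
  assumes "((\<lambda>e. (\<Sum>n. log_term t (1 + e) n) / ln (1 / e)) \<longlongrightarrow> l) (at_right 0)"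
  shows "((\<lambda>x. (\<Sum>n | real n \<le> x. prime_term t n) / ln (ln x)) \<longlongrightarrow> l) at_top"
proof -
  let ?z = "prime_term (\<lambda>_. 0)"
  note zlim = prime_term_limit_if_log_term_limit[OF log_zeta_limit]
  note tlim = prime_term_limit_if_log_term_limit[OF assms]
  have Z: "((\<lambda>x. (\<Sum>n | real n \<le> x. ?z n) / ln (ln x)) \<longlongrightarrow> 2) at_top"
    by (rule tauberian_ln[OF _ _ summable_prime_term zlim]) (auto simp: prime_term_def)
  have eq: "(\<Sum>n. (prime_term t n + ?z n) * real n powr - e) / ln (1 / e) =
      (\<Sum>n. prime_term t n * real n powr - e) / ln (1 / e) + (\<Sum>n. ?z n * real n powr - e) / ln (1 / e)"
    if "e > 0" for e
    by (simp only: distrib_right suminf_add[OF summable_prime_term summable_prime_term, OF that that, symmetric]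
        add_divide_distrib)
  have "((\<lambda>x. (\<Sum>n | real n \<le> x. prime_term t n + ?z n) / ln (ln x)) \<longlongrightarrow> l + 2) at_top"
  proof (rule tauberian_ln)
    show "prime_term t n + ?z n \<ge> 0" for n
    proof -
      have "2 * cos (t n) + 2 \<ge> 0" using cos_ge_minus_one[of "t n"] by linarith
      then show ?thesis by (auto simp: prime_term_def add_divide_distrib[symmetric])
    qed
    show "prime_term t 0 + ?z 0 = 0" by (simp add: prime_term_def)
    show "summable (\<lambda>n. (prime_term t n + ?z n) * real n powr - e)" if "e > 0" for e
      unfolding distrib_right by (intro summable_add summable_prime_term that)
    show "((\<lambda>e. (\<Sum>n. (prime_term t n + ?z n) * real n powr - e) / ln (1 / e)) \<longlongrightarrow> l + 2) (at_right 0)"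
      by (rule Lim_transform_eventually[OF tendsto_add[OF tlim zlim]])
         (use eventually_at_right_less[of 0] in eventually_elim, rule eq[symmetric])
  qed
  from tendsto_diff[OF this Z] show ?thesis by (simp add: sum.distrib add_divide_distrib)
qed

subsection \<open>The pole order at 1\<close>

text \<open>Squaring doubles the angles, so the product defining \<delta>(M) has the same shape as
  the original and the results for general angles \<open>t\<close> apply to it.\<close>

lemma ramanujan_M_squared: "ramanujan_M \<theta> p ** ramanujan_M \<theta> p = ramanujan_M (\<lambda>p. 2 * \<theta> p) p"
proof -
  have "cis x * cis x = cis (2 * x)" "cis (- x) * cis (- x) = cis (- (2 * x))" for x
    by (simp_all add: cis_mult)
  then show ?thesis
    unfolding vec_eq_iff forall_2
    by (simp add: ramanujan_M_def matrix_matrix_mult_def sum_2)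
qed

text \<open>Near 1 the continuation factors as \<open>g w * (w - 1) powi - d\<close> with
  \<open>g 1 \<noteq> 0\<close>, and at \<open>1 + e\<close> it equals \<open>exp (L e)\<close>.
  Taking logarithms of norms gives \<open>L e\<close> as \<open>d * ln (1 / e)\<close> plus a
  convergent term.\<close>

lemma log_term_limit_of_pole_order:
  assumes "euler_pole_order_at_1 (ramanujan_M t) d"
  shows "((\<lambda>e. (\<Sum>n. log_term t (1 + e) n) / ln (1 / e)) \<longlongrightarrow> of_int d) (at_right 0)"
proof -
  define L where "L e = (\<Sum>n. log_term t (1 + e) n)" for e
  obtain F where F: "F meromorphic_on insert 1 {s. Re s > 1}"
    "\<And>s. Re s > 1 \<Longrightarrow> has_euler_product (ramanujan_M t) s (F s)" "zorder F 1 = - d"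
    using assms unfolding euler_pole_order_at_1_def by blast
  have FL: "F (of_real (1 + e)) = of_real (exp (L e))" if "e > 0" for e
  proof -
    define s where "s = complex_of_real (1 + e)"
    have fac: "euler_factor (ramanujan_M t p) p s =
        of_real (inverse (1 - 2 * cos (t p) * real p powr - (1 + e) + (real p powr - (1 + e))\<^sup>2))"
      if "prime p" for p
    proof -
      have "(of_nat p :: complex) powr - s = of_real (real p powr - (1 + e))"
        using powr_of_real[of "real p" "- (1 + e)"] by (simp add: s_def)
      moreover have "(of_nat p :: complex) powr (- 2 * s) = of_real (real p powr - (2 * (1 + e)))"
        using powr_of_real[of "real p" "- (2 * (1 + e))"] by (simp add: s_def algebra_simps)
      ultimately show ?thesis
        using prime_gt_0_nat[OF that]
        unfolding euler_factor_ramanujan_M[OF prime_gt_0_nat[OF that]] powr_minus_power2 by simp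
    qed
    have "((\<lambda>x::real. \<Prod>p | prime p \<and> real p \<le> x. euler_factor (ramanujan_M t p) p s) \<longlongrightarrow> F s) at_top"
      using F(2)[of s] that by (simp add: has_euler_product_def s_def)
    from filterlim_compose[OF this filterlim_real_sequentially]
    have "(\<lambda>N::nat. \<Prod>p | prime p \<and> p \<le> N. euler_factor (ramanujan_M t p) p s) \<longlonglongrightarrow> F s"
      by simp
    moreover have "(\<Prod>p | prime p \<and> p \<le> N. euler_factor (ramanujan_M t p) p s)
        = of_real (exp (\<Sum>n\<le>N. log_term t (1 + e) n))" for N
    proof -
      have "(\<Prod>p | prime p \<and> p \<le> N. euler_factor (ramanujan_M t p) p s) =
          (\<Prod>p\<in>{p\<in>{..N}. prime p}.
            of_real (inverse (1 - 2 * cos (t p) * real p powr - (1 + e) + (real p powr - (1 + e))\<^sup>2)))"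
        by (intro prod.cong) (auto simp: fac)
      then show ?thesis using that by (subst exp_sum_log_term) auto
    qed
    ultimately have "(\<lambda>N. complex_of_real (exp (\<Sum>n\<le>N. log_term t (1 + e) n))) \<longlonglongrightarrow> F s" by simp
    moreover have "(\<lambda>N. complex_of_real (exp (\<Sum>n\<le>N. log_term t (1 + e) n))) \<longlonglongrightarrow> of_real (exp (L e))"
      unfolding L_def by (intro tendsto_of_real tendsto_exp summable_LIMSEQ' summable_log_term that)
    ultimately show ?thesis unfolding s_def[symmetric] by (rule LIMSEQ_unique)
  qed
  have "F meromorphic_on {1}" by (rule meromorphic_on_subset[OF F(1)]) auto
  then have iso: "isolated_singularity_at F 1" "not_essential F 1"
    by (simp_all add: meromorphic_at_iff)
  \<comment> \<open>The factorization at 1 requires that \<open>F\<close> is not identically zero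
    nearby; it is an exponential at the points \<open>1 + e\<close>.\<close>
  have "\<exists>\<^sub>F s in at 1. F s \<noteq> 0"
    unfolding frequently_at
  proof (intro allI impI)
    fix r :: real assume "r > 0"
    then show "\<exists>s\<in>UNIV. s \<noteq> 1 \<and> dist s 1 < r \<and> F s \<noteq> 0"
      using FL[of "r / 2"] by (intro bexI[of _ "of_real (1 + r / 2)"]) (auto simp: dist_norm)
  qed
  then obtain g r where g: "g 1 \<noteq> 0" "r > 0" "g holomorphic_on cball 1 r"
    "\<And>w. w \<in> cball 1 r - {1} \<Longrightarrow> F w = g w * (w - 1) powi - d"
    using zorder_exist[OF iso] F(3) by metis
  have Leq: "L e = ln (norm (g (of_real (1 + e)))) + of_int d * ln (1 / e)" if "0 < e" "e < r" for e
  proof -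
    define w where "w = complex_of_real (1 + e)"
    have "w \<in> cball 1 r - {1}" using that by (auto simp: w_def dist_norm)
    then have "F w = g w * (w - 1) powi - d" by (rule g(4))
    moreover have "w - 1 = of_real e" by (simp add: w_def)
    ultimately have "exp (L e) = norm (g w) * e powi - d"
      using FL[OF that(1)] that by (metis abs_exp_cancel abs_of_pos norm_mult norm_of_real norm_power_int w_def)
    also have "e powi - d = e powr - of_int d"
      using that powr_real_of_int'[of e "- d"] by simp
    finally have eq: "exp (L e) = norm (g w) * e powr - of_int d" .
    then have "norm (g w) \<noteq> 0" by auto
    have "L e = ln (norm (g w) * e powr - of_int d)" unfolding eq[symmetric] by simp
    also have "\<dots> = ln (norm (g w)) + of_int d * ln (1 / e)"
      using \<open>norm (g w) \<noteq> 0\<close> that by (simp add: ln_mult ln_powr ln_div)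
    finally show ?thesis by (simp add: w_def)
  qed
  have "isCont g 1"
    using g(2,3) by (intro continuous_on_interior[OF holomorphic_on_imp_continuous_on]) auto
  moreover have "((\<lambda>e. complex_of_real (1 + e)) \<longlongrightarrow> of_real (1 + 0)) (at_right 0)"
    by (intro tendsto_intros)
  ultimately have "((\<lambda>e. g (of_real (1 + e))) \<longlongrightarrow> g 1) (at_right 0)"
    by (intro isCont_tendsto_compose[of _ g]) auto
  then have "((\<lambda>e. ln (norm (g (of_real (1 + e))))) \<longlongrightarrow> ln (norm (g 1))) (at_right 0)"
    using g(1) by (intro tendsto_intros) auto
  moreover have "((\<lambda>e. inverse (ln (1 / e))) \<longlongrightarrow> 0) (at_right (0::real))" by real_asymp
  ultimately have "((\<lambda>e. ln (norm (g (of_real (1 + e)))) * inverse (ln (1 / e)) + of_int d)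
      \<longlongrightarrow> ln (norm (g 1)) * 0 + of_int d) (at_right 0)"
    by (intro tendsto_add tendsto_mult tendsto_const)
  then have "((\<lambda>e. ln (norm (g (of_real (1 + e)))) * inverse (ln (1 / e)) + of_int d)
      \<longlongrightarrow> of_int d) (at_right 0)" by simp
  then show ?thesis
    unfolding L_def[symmetric]
  proof (rule Lim_transform_eventually)
    have "\<forall>\<^sub>F e::real in at_right 0. 0 < e \<and> e < r \<and> ln (1 / e) > 0"
      using g(2) by (intro eventually_conj; real_asymp)
    then show "\<forall>\<^sub>F e in at_right 0. ln (norm (g (of_real (1 + e)))) * inverse (ln (1 / e)) + of_int d
        = L e / ln (1 / e)"
    proof eventually_elim
      case (elim e)
      then have e: "0 < e" "e < r" "ln (1 / e) \<noteq> 0" by (blast, blast, linarith)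
      have "a * inverse k + of_int d = (a + of_int d * k) / k" if "k \<noteq> 0" for a k :: real
        using that by (simp add: field_simps)
      from this[OF e(3)] show ?case unfolding Leq[OF e(1,2)] .
    qed
  qed
qed

subsection \<open>The central point\<close>

lemma tendsto_bounded_over_ln_ln:
  assumes "\<forall>\<^sub>F x in at_top. \<bar>f x\<bar> \<le> C"
  shows "((\<lambda>x. f x / ln (ln x)) \<longlongrightarrow> (0::real)) at_top"
proof (rule Lim_null_comparison)
  show "((\<lambda>x. C / ln (ln x)) \<longlongrightarrow> 0) at_top" by real_asymp
  have "\<forall>\<^sub>F x::real in at_top. ln (ln x) > 0" by real_asymp
  with assms show "\<forall>\<^sub>F x in at_top. norm (f x / ln (ln x)) \<le> C / ln (ln x)"
    by eventually_elim (simp add: divide_right_mono)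
qed

lemma powr_minus_half_power2: "x \<ge> 0 \<Longrightarrow> (x powr - (1 / 2))\<^sup>2 = inverse x" for x :: real
  using powr_minus[of x 1] by (cases "x = 0") (simp_all add: powr_minus_power2)

text \<open>On the critical line the quadratic term \<open>cos (2 * t p) / p\<close> has to be kept:
  it is half of \<open>prime_term\<close> at the doubled angle. The cubic remainder is dominated by
  the convergent series of \<open>n powr - (3 / 2)\<close>.\<close>

lemma half_line_log_sum:
  fixes t :: "nat \<Rightarrow> real" and x :: real
  shows "\<bar>(\<Sum>n | real n \<le> x. log_term t (1 / 2) n)
      - (\<Sum>p | prime p \<and> real p \<le> x. 2 * cos (t p) * real p powr - (1 / 2))
      - (\<Sum>n | real n \<le> x. prime_term (\<lambda>p. 2 * t p) n) / 2\<bar> \<le> (\<Sum>n. 500 * real n powr - (3 / 2))"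
proof -
  define b where "b n = (if prime n then 2 * cos (t n) * real n powr - (1 / 2) else 0)" for n
  let ?h = "\<lambda>n. log_term t (1 / 2) n - b n - prime_term (\<lambda>p. 2 * t p) n / 2"
  have bound: "\<bar>?h n\<bar> \<le> 500 * real n powr - (3 / 2)" for n
  proof (cases "prime n")
    case True
    define u where "u = real n powr - (1 / 2)"
    have "real n > 0" using prime_gt_0_nat[OF True] by simp
    then have u2: "u\<^sup>2 = inverse (real n)"
      by (simp add: u_def powr_minus_half_power2)
    have "u ^ 3 = u * u\<^sup>2" by (simp add: power3_eq_cube power2_eq_square)
    moreover have "real n powr - (3 / 2) = u / real n"
      using powr_minus_one_plus[of "real n" "1 / 2"] by (simp add: u_def)
    ultimately have u3: "u ^ 3 = real n powr - (3 / 2)"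
      by (simp only: u2 divide_inverse)
    have "\<bar>log_factor (t n) u - 2 * cos (t n) * u - cos (2 * t n) * u\<^sup>2\<bar> \<le> 500 * u ^ 3"
      by (rule log_factor_cubic_bound) (use prime_powr_le[OF True, of "1 / 2"] in \<open>auto simp: u_def\<close>)
    moreover have "prime_term (\<lambda>p. 2 * t p) n / 2 = cos (2 * t n) * u\<^sup>2"
      using True by (simp add: prime_term_def u2 inverse_eq_divide)
    ultimately show ?thesis
      using True by (simp only: log_term_def b_def if_True u_def[symmetric] u3)
  qed (simp add: log_term_def b_def prime_term_def)
  have "(\<Sum>p | prime p \<and> real p \<le> x. 2 * cos (t p) * real p powr - (1 / 2)) = (\<Sum>n | real n \<le> x. b n)"
    unfolding b_def using finite_real_le
    by (subst sum.inter_filter[symmetric]) (auto intro!: sum.cong)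
  then have "\<bar>(\<Sum>n | real n \<le> x. log_term t (1 / 2) n)
      - (\<Sum>p | prime p \<and> real p \<le> x. 2 * cos (t p) * real p powr - (1 / 2))
      - (\<Sum>n | real n \<le> x. prime_term (\<lambda>p. 2 * t p) n) / 2\<bar> = \<bar>\<Sum>n | real n \<le> x. ?h n\<bar>"
    by (simp add: sum_subtractf sum_divide_distrib)
  also have "\<dots> \<le> (\<Sum>n | real n \<le> x. 500 * real n powr - (3 / 2))"
    by (rule order_trans[OF sum_abs sum_mono]) (rule bound)
  also have "\<dots> \<le> (\<Sum>n. 500 * real n powr - (3 / 2))"
    by (intro sum_le_suminf summable_mult finite_real_le) (auto simp: summable_real_powr_iff)
  finally show ?thesis .
qed

theorem theorem2:
  fixes \<theta> :: "nat \<Rightarrow> real" and \<delta> :: int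
  assumes theta: "is_ramanujan_angle \<theta>"
    and L_nonzero: "ramanujan_L 6 \<noteq> 0"
    and delta: "is_delta (ramanujan_M \<theta>) \<delta>" "\<delta> = -1"
    and DRH: "((\<lambda>x::real. complex_of_real
                 (\<Prod>p | prime p \<and> real p \<le> x.
                    inverse (1 - 2 * cos (\<theta> p) * real p powr (-1/2) + inverse (real p))))
               \<longlongrightarrow> of_real (sqrt 2) powi \<delta> * ramanujan_L 6) at_top"
  shows "(\<lambda>x::real. \<Sum>p | prime p \<and> real p \<le> x. real_of_int (ramanujan_tau p) / real p ^ 6)
           \<sim>[at_top] (\<lambda>x. 1/2 * ln (ln x))"
proof -
  define V where "V x = (\<Sum>n | real n \<le> x. log_term \<theta> (1 / 2) n)" for x
  define T where "T x = (\<Sum>p | prime p \<and> real p \<le> x. 2 * cos (\<theta> p) * real p powr - (1 / 2))" for x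
  define U where "U x = (\<Sum>n | real n \<le> x. prime_term (\<lambda>p. 2 * \<theta> p) n)" for x
  define c where "c = of_real (sqrt 2) powi \<delta> * ramanujan_L 6"
  \<comment> \<open>Without a nonzero limit the logarithms \<open>V x\<close> of the partial
    products could be unbounded.\<close>
  have "c \<noteq> 0" using L_nonzero by (simp add: c_def power_int_eq_0_iff)
  have tau: "real_of_int (ramanujan_tau p) / real p ^ 6 = 2 * cos (\<theta> p) * real p powr - (1 / 2)"
    if "prime p" for p
  proof -
    have "real p > 0" using prime_gt_0_nat[OF that] by simp
    then have "real p powr (11 / 2) / real p ^ 6 = real p powr - (1 / 2)"
      using powr_diff[of "real p" "11 / 2" 6] by simp
    moreover have "real_of_int (ramanujan_tau p) / real p ^ 6
        = 2 * cos (\<theta> p) * (real p powr (11 / 2) / real p ^ 6)"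
      using theta that by (simp add: is_ramanujan_angle_def)
    ultimately show ?thesis by (simp only:)
  qed
  have euler: "(\<Prod>p | prime p \<and> real p \<le> x.
      inverse (1 - 2 * cos (\<theta> p) * real p powr (-1/2) + inverse (real p))) = exp (V x)" for x
    unfolding V_def exp_sum_log_term[OF finite_real_le order_refl]
  proof (intro prod.cong)
    fix p assume "p \<in> {n \<in> {n. real n \<le> x}. prime n}"
    then have "real p > 0" using prime_gt_0_nat by auto
    then show "inverse (1 - 2 * cos (\<theta> p) * real p powr (-1/2) + inverse (real p)) =
        inverse (1 - 2 * cos (\<theta> p) * real p powr - (1 / 2) + (real p powr - (1 / 2))\<^sup>2)"
      by (simp add: powr_minus_half_power2)
  qed auto
  have "((\<lambda>x. complex_of_real (exp (V x))) \<longlongrightarrow> c) at_top"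
    using DRH unfolding euler c_def .
  \<comment> \<open>The hypothesis gives a complex limit; passing to norms makes the real logarithm
    applicable.\<close>
  from tendsto_norm[OF this] have "((\<lambda>x. exp (V x)) \<longlongrightarrow> norm c) at_top" by simp
  from tendsto_ln[OF this] have "(V \<longlongrightarrow> ln (norm c)) at_top" using \<open>c \<noteq> 0\<close> by simp
  from tendsto_norm[OF this] have "\<forall>\<^sub>F x in at_top. \<bar>V x\<bar> < \<bar>ln (norm c)\<bar> + 1"
    by (intro order_tendstoD(2)) auto
  then have "\<forall>\<^sub>F x in at_top. \<bar>V x\<bar> \<le> \<bar>ln (norm c)\<bar> + 1"
    by eventually_elim simp
  then have Vlim: "((\<lambda>x. V x / ln (ln x)) \<longlongrightarrow> 0) at_top"
    by (rule tendsto_bounded_over_ln_ln)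
  have Rlim: "((\<lambda>x. (V x - T x - U x / 2) / ln (ln x)) \<longlongrightarrow> 0) at_top"
    unfolding V_def T_def U_def
    by (rule tendsto_bounded_over_ln_ln[OF always_eventually[OF allI[OF half_line_log_sum]]])
  \<comment> \<open>A simple zero at 1 of the L-function with doubled angles makes
    \<open>U x\<close> behave like \<open>- ln (ln x)\<close>.\<close>
  have "euler_pole_order_at_1 (ramanujan_M (\<lambda>p. 2 * \<theta> p)) (- 1)"
    using delta by (simp add: is_delta_def ramanujan_M_squared)
  from prime_term_partial_sums_limit[OF log_term_limit_of_pole_order[OF this]]
  have Ulim: "((\<lambda>x. U x / ln (ln x)) \<longlongrightarrow> - 1) at_top" by (simp add: U_def)
  \<comment> \<open>Twice \<open>T\<close> is \<open>2 * V - U\<close> minus twice the bounded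
    remainder; only \<open>U\<close> survives division by \<open>ln (ln x)\<close>, and the limit is
    1.\<close>
  have "((\<lambda>x. 2 * (V x / ln (ln x)) - U x / ln (ln x) - 2 * ((V x - T x - U x / 2) / ln (ln x)))
      \<longlongrightarrow> 2 * 0 - (- 1) - 2 * 0) at_top"
    by (intro tendsto_intros Vlim Ulim Rlim)
  moreover have "2 * (V x / ln (ln x)) - U x / ln (ln x) - 2 * ((V x - T x - U x / 2) / ln (ln x))
      = T x / (1/2 * ln (ln x))" for x
    by (simp add: diff_divide_distrib)
  ultimately have "T \<sim>[at_top] (\<lambda>x. 1/2 * ln (ln x))"
    by (intro asymp_equivI') simp
  moreover have "T = (\<lambda>x. \<Sum>p | prime p \<and> real p \<le> x. real_of_int (ramanujan_tau p) / real p ^ 6)"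
    unfolding T_def by (intro ext sum.cong) (auto simp: tau)
  ultimately show ?thesis by (simp only:)
qed

end
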